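(* Let $G_\bullet$ be a prefiltration of length $d\in\{-\infty\}\cup\mathbb N$, let $\Gamma$ be a set and let $\mathcal T$ be a set of partially defined maps $T:\Gamma\supset\operatorname{dom}(T)\to\Gamma$. Then the set $P(\Gamma,G_\bullet)$ of $G_\bullet$-polynomial maps on $\Gamma$ (with respect to $\mathcal T$) is a group under pointwise operations, and it admits a canonical prefiltration of length $d$ given by \[ P(\Gamma,G_\bullet)\ \geq\ P(\Gamma,G_{\bullet+1})\ \geq\ \dots\ \geq\ P(\Gamma,G_{\bullet+d+1}). \]
   Context: $\mathbb N=\{0,1,2,\dots\}$. A prefiltration $G_\bullet$ is a sequence of nested groups $G_0\geq G_1\geq G_2\geq\dots$ such that $[G_i,G_j]\subset G_{i+j}$ for all $i,j\in\mathbb N$. It has length $d\in\mathbb N$ if $G_{d+1}$ is the trivial group, and length $-\infty$ if $G_0$ is the trivial group; for $t\in\mathbb N$ one puts $d-t=-\infty$ if $d<t$. For $t\in\mathbb N$, $G_{\bullet+t}$ is the prefiltration (of length $d-t$) given by $(G_{\bullet+t})_i=G_{i+t}$. $G_\bullet$-polynomial maps are defined by induction on the length $d$ of the prefiltration: a map $g:\Gamma\to G_0$ is $G_\bullet$-polynomial (with respect to $\mathcal T$) if either $d=-\infty$ (so that $g$ is identically the identity) or for every $T\in\mathcal T$ there exists a $G_{\bullet+1}$-polynomial map $D_Tg:\Gamma\to G_1$ such that $D_Tg(x)=g(x)^{-1}g(Tx)$ for all $x\in\operatorname{dom}(T)$. $P(\Gamma,G_\bullet)$ denotes the set of $G_\bullet$-polynomial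 maps. *)

theory Defs
  imports "HOL-Algebra.Generated_Groups" "HOL-Algebra.Product_Groups"
begin

text \<open>The members of a prefiltration are subgroups of one ambient group \<open>G\<close>, which may be larger than
  \<open>F 0\<close>. The condition on commutators uses the subgroup generated by all commutators.\<close>

definition commutator_subgroup ::
    "('a, 'm) monoid_scheme \<Rightarrow> 'a set \<Rightarrow> 'a set \<Rightarrow> 'a set" where
  "commutator_subgroup G A B =
     generate G (\<Union>a\<in>A. \<Union>b\<in>B. {inv\<^bsub>G\<^esub> a \<otimes>\<^bsub>G\<^esub> inv\<^bsub>G\<^esub> b \<otimes>\<^bsub>G\<^esub> a \<otimes>\<^bsub>G\<^esub> b})"

locale prefiltration = group G
  for G :: "('a, 'm) monoid_scheme" (structure) +
  fixes F :: "nat \<Rightarrow> 'a set"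
  assumes subgroups: "\<And>i. subgroup (F i) G"
    and nested: "\<And>i. F (Suc i) \<subseteq> F i"
    and commutators: "\<And>i j. commutator_subgroup G (F i) (F j) \<subseteq> F (i + j)"

datatype prefiltration_length = Minus_Infinity | Finite nat

text \<open>A prefiltration has many lengths: having length \<open>d\<close> only bounds its support.\<close>

fun has_length ::
    "('a, 'm) monoid_scheme \<Rightarrow> (nat \<Rightarrow> 'a set) \<Rightarrow> prefiltration_length \<Rightarrow> bool" where
  "has_length G F Minus_Infinity \<longleftrightarrow> F 0 = {\<one>\<^bsub>G\<^esub>}"
| "has_length G F (Finite d) \<longleftrightarrow> F (Suc d) = {\<one>\<^bsub>G\<^esub>}"

fun length_minus :: "prefiltration_length \<Rightarrow> nat \<Rightarrow> prefiltration_length" where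
  "length_minus Minus_Infinity t = Minus_Infinity"
| "length_minus (Finite d) t = (if d < t then Minus_Infinity else Finite (d - t))"

definition shift :: "(nat \<Rightarrow> 'a set) \<Rightarrow> nat \<Rightarrow> (nat \<Rightarrow> 'a set)" where
  "shift F t = (\<lambda>i. F (i + t))"

text \<open>Maps on \<open>\<Gamma>\<close> are extensional functions, and a partially defined map \<open>T\<close> is an element of
  \<open>'x \<rightharpoonup> 'x\<close>. The argument \<open>d\<close> is a length of \<open>F\<close>, on which the recursion runs; the set does not
  depend on which length of \<open>F\<close> is chosen, see \<open>polynomial_maps_length_irrelevant\<close> below.\<close>

function polynomial_maps ::
    "('a, 'm) monoid_scheme \<Rightarrow> 'x set \<Rightarrow> ('x \<rightharpoonup> 'x) set \<Rightarrow> prefiltration_length \<Rightarrow>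
     (nat \<Rightarrow> 'a set) \<Rightarrow> ('x \<Rightarrow> 'a) set" where
  "polynomial_maps G \<Gamma> \<T> Minus_Infinity F = (\<Gamma> \<rightarrow>\<^sub>E F 0)"
| "polynomial_maps G \<Gamma> \<T> (Finite d) F =
     {g \<in> \<Gamma> \<rightarrow>\<^sub>E F 0. \<forall>T\<in>\<T>. \<exists>h \<in> polynomial_maps G \<Gamma> \<T> (length_minus (Finite d) 1) (shift F 1).
        \<forall>x\<in>dom T. h x = inv\<^bsub>G\<^esub> (g x) \<otimes>\<^bsub>G\<^esub> g (the (T x))}"
  by pat_completeness auto
termination
  by (relation "measure (\<lambda>(G, \<Gamma>, \<T>, d, F). case d of Minus_Infinity \<Rightarrow> 0 | Finite n \<Rightarrow> Suc n)") auto

declare polynomial_maps.simps [simp del]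

lemma polynomial_maps_trivial:
  assumes "group G" and "\<And>i. F i = {\<one>\<^bsub>G\<^esub>}"
    and dom: "\<And>T. T \<in> \<T> \<Longrightarrow> dom T \<subseteq> \<Gamma> \<and> ran T \<subseteq> \<Gamma>"
  shows "polynomial_maps G \<Gamma> \<T> d F = (\<Gamma> \<rightarrow>\<^sub>E F 0)"
  using assms(1-3)
proof (induction G \<Gamma> \<T> d F rule: polynomial_maps.induct)
  case (2 G \<Gamma> \<T> d F)
  interpret group G by (fact 2)
  have IH: "polynomial_maps G \<Gamma> \<T> (length_minus (Finite d) 1) (shift F 1) = (\<Gamma> \<rightarrow>\<^sub>E {\<one>\<^bsub>G\<^esub>})"
    if "T \<in> \<T>" for T
    using "2.IH"[OF that] "2.prems" by (simp add: shift_def)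
  have "\<exists>h \<in> polynomial_maps G \<Gamma> \<T> (length_minus (Finite d) 1) (shift F 1).
        \<forall>x\<in>dom T. h x = inv\<^bsub>G\<^esub> (g x) \<otimes>\<^bsub>G\<^esub> g (the (T x))"
    if g: "g \<in> \<Gamma> \<rightarrow>\<^sub>E F 0" and T: "T \<in> \<T>" for g T
  proof -
    have "g x = \<one>\<^bsub>G\<^esub> \<and> g (the (T x)) = \<one>\<^bsub>G\<^esub>" if "x \<in> dom T" for x
    proof -
      have "x \<in> \<Gamma>" "the (T x) \<in> \<Gamma>"
        using that "2.prems"(3)[OF T] by (auto simp: ran_def)
      then show ?thesis using g "2.prems"(2) by (auto simp: PiE_iff)
    qed
    moreover have "(\<lambda>x\<in>\<Gamma>. \<one>\<^bsub>G\<^esub>) \<in> polynomial_maps G \<Gamma> \<T> (length_minus (Finite d) 1) (shift F 1)"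
      unfolding IH[OF T] by auto
    ultimately show ?thesis
      using "2.prems"(3)[OF T] by (intro bexI[of _ "\<lambda>x\<in>\<Gamma>. \<one>\<^bsub>G\<^esub>"]) auto
  qed
  then show ?case unfolding polynomial_maps.simps(2) by blast
qed (simp only: polynomial_maps.simps(1))

lemma has_length_shift:
  assumes "prefiltration G F" and "has_length G F d"
  shows "has_length G (shift F t) (length_minus d t)"
proof -
  interpret prefiltration G F by fact
  have mono: "F j \<subseteq> F i" if "i \<le> j" for i j
    using that by (rule lift_Suc_antimono_le[of F, OF nested])
  have triv: "F j = {\<one>\<^bsub>G\<^esub>}" if "F i = {\<one>\<^bsub>G\<^esub>}" "i \<le> j" for i j
    using mono[OF that(2)] that(1) subgroup.one_closed[OF subgroups, of j] by auto
  show ?thesis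
  proof (cases d)
    case Minus_Infinity
    then show ?thesis using assms(2) triv[of 0 t] by (simp add: shift_def)
  next
    case (Finite n)
    then have "F (Suc n) = {\<one>\<^bsub>G\<^esub>}" using assms(2) by simp
    from triv[OF this] show ?thesis by (simp add: Finite shift_def)
  qed
qed

lemma prefiltration_shift:
  assumes "prefiltration G F"
  shows "prefiltration G (shift F t)"
proof -
  interpret prefiltration G F by fact
  have mono: "F j \<subseteq> F i" if "i \<le> j" for i j
    using that by (rule lift_Suc_antimono_le[of F, OF nested])
  have "commutator_subgroup G (F (i + t)) (F (j + t)) \<subseteq> F (i + j + t)" for i j
    using commutators[of "i + t" "j + t"] mono[of "i + j + t" "i + t + (j + t)"] by auto
  then show ?thesis
    using subgroups nested
    by (intro prefiltration.intro group_axioms prefiltration_axioms.intro)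
      (simp_all add: shift_def)
qed

lemma polynomial_maps_length_irrelevant:
  assumes "prefiltration G F" and "has_length G F d" and "has_length G F d'"
    and "\<And>T. T \<in> \<T> \<Longrightarrow> dom T \<subseteq> \<Gamma> \<and> ran T \<subseteq> \<Gamma>"
  shows "polynomial_maps G \<Gamma> \<T> d F = polynomial_maps G \<Gamma> \<T> d' F"
  using assms
proof (induction G \<Gamma> \<T> d F arbitrary: d' rule: polynomial_maps.induct)
  case (1 G \<Gamma> \<T> F)
  have "F i = {\<one>\<^bsub>G\<^esub>}" for i
    using has_length_shift[OF "1.prems"(1,2), of i] by (simp add: shift_def)
  note triv = polynomial_maps_trivial[of G F \<T> \<Gamma>,
      OF prefiltration.axioms(1)[OF "1.prems"(1)] this "1.prems"(4)]
  show ?case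
    by (simp only: triv)
next
  case (2 G \<Gamma> \<T> d F)
  show ?case
  proof (cases d')
    case Minus_Infinity
    have "F i = {\<one>\<^bsub>G\<^esub>}" for i
      using has_length_shift[OF "2.prems"(1,3), of i] Minus_Infinity by (simp add: shift_def)
    note triv = polynomial_maps_trivial[of G F \<T> \<Gamma>,
      OF prefiltration.axioms(1)[OF "2.prems"(1)] this "2.prems"(4)]
    show ?thesis
      by (simp only: triv)
  next
    case (Finite n)
    have "polynomial_maps G \<Gamma> \<T> (length_minus (Finite d) 1) (shift F 1) =
        polynomial_maps G \<Gamma> \<T> (length_minus d' 1) (shift F 1)" if "T \<in> \<T>" for T
      by (rule "2.IH"[OF that prefiltration_shift[OF "2.prems"(1)]
            has_length_shift[OF "2.prems"(1,2)] has_length_shift[OF "2.prems"(1,3)] "2.prems"(4)])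
    then show ?thesis
      unfolding Finite by (simp only: polynomial_maps.simps(2) cong: ball_cong)
  qed
qed

end

theory Submission
  imports Defs
begin

text \<open>
  Write \<open>P t\<close> for the polynomial maps with values in the filtration shifted by \<open>t\<close>, write
  \<open>[a, b] = a\<inverse> b\<inverse> a b\<close>, and call any \<open>u \<in> P (t + 1)\<close> with \<open>g (T x) = g x \<cdot> u x\<close> on the domain
  of \<open>T\<close> a derivative of \<open>g \<in> P t\<close>. To see that a map built from polynomial maps is polynomial, one
  has to write its derivative as a product of maps already known to lie in the next group. For a
  product \<open>f g\<close> with derivatives \<open>u\<close>, \<open>v\<close> this derivative is \<open>g\<inverse> u g \<cdot> v\<close>, for \<open>f\<inverse>\<close> it is
  \<open>(f u f\<inverse>)\<inverse>\<close>. So closure under the group operations needs control of conjugates, hence of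
  commutators, whose derivatives again contain products and inverses.

  Two inductions break the circle. The outer one is on the length of the filtration. Applied to the
  filtration shifted by one, it says that \<open>P 1, P 2, \<dots>\<close> are groups and that
  \<open>[P i, P j] \<subseteq> P (i + j - 1)\<close> for positive \<open>i\<close>, \<open>j\<close>: the commutator estimate is off by one, but it
  suffices to see that each of these groups is normalised by all of them. The inner inductions run
  downwards from the index at which the filtration has become trivial.

  The first of them improves the estimate to \<open>[P i, P j] \<subseteq> P (i + j)\<close> for positive \<open>i\<close>, \<open>j\<close>
  (\<open>P_commutator_pos\<close>). It rests on the identity \<open>commutator_increment\<close>, which expresses the
  derivative of \<open>[f, g]\<close>, up to conjugation by \<open>f g\<close>, as a product of three commutators of total
  index \<open>i + j + 1\<close> or more. The second shows that \<open>f P m f\<inverse> \<subseteq> P m\<close> for \<open>f \<in> P 0\<close> and \<open>m > 0\<close>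
  (\<open>P_conj\<close>); since the derivative of \<open>f\<close> lies in the group \<open>P 1\<close>, only the commutator estimate for
  positive indices enters, and in particular no inverse of \<open>f\<close> in \<open>P 0\<close> is presupposed. The formulas
  for the derivatives of \<open>f\<inverse>\<close> and \<open>f g\<close> then show that \<open>P 0\<close> is a group, and \<open>[P 0, P n] \<subseteq> P n\<close>
  is just the statement that \<open>P 0\<close> normalises \<open>P n\<close>.
\<close>

section \<open>Identities in a group\<close>

definition commutator :: "('a, 'm) monoid_scheme \<Rightarrow> 'a \<Rightarrow> 'a \<Rightarrow> 'a" where
  "commutator G a b = inv\<^bsub>G\<^esub> a \<otimes>\<^bsub>G\<^esub> inv\<^bsub>G\<^esub> b \<otimes>\<^bsub>G\<^esub> a \<otimes>\<^bsub>G\<^esub> b"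

lemma commutator_in_commutator_subgroup:
  assumes "a \<in> A" and "b \<in> B"
  shows "commutator G a b \<in> commutator_subgroup G A B"
  unfolding commutator_subgroup_def commutator_def using assms by (intro generate.incl) blast

context group
begin

lemma inv_mult_cancel_left:
  "x \<in> carrier G \<Longrightarrow> y \<in> carrier G \<Longrightarrow> inv x \<otimes> (x \<otimes> y) = y"
  by (simp flip: m_assoc)

lemma mult_inv_cancel_left:
  "x \<in> carrier G \<Longrightarrow> y \<in> carrier G \<Longrightarrow> x \<otimes> (inv x \<otimes> y) = y"
  by (simp flip: m_assoc)

text \<open>These rules reduce words in group elements and their inverses to freely reduced form.\<close>

lemmas word_simps = m_assoc inv_mult_group inv_mult_cancel_left mult_inv_cancel_left

lemma conj_eq_mult_commutator:
  "g \<in> carrier G \<Longrightarrow> u \<in> carrier G \<Longrightarrow> inv g \<otimes> u \<otimes> g = u \<otimes> commutator G u g"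
  by (simp add: commutator_def word_simps)

text \<open>The left side is the derivative of \<open>[a, b]\<close> when \<open>a\<close>, \<open>b\<close> have derivatives \<open>u\<close>, \<open>v\<close>. The
  point of the right side is that \<open>[a, b]\<close> has disappeared: after conjugation by \<open>a b\<close> only
  commutators remain in which a conjugate of \<open>u\<close> or of \<open>v\<close> is an entry, and each of these gains an
  index over \<open>[a, b]\<close>.\<close>

lemma commutator_increment:
  assumes "a \<in> carrier G" "b \<in> carrier G" "u \<in> carrier G" "v \<in> carrier G"
  defines "c \<equiv> a \<otimes> u \<otimes> inv a" and "e \<equiv> b \<otimes> v \<otimes> inv b"
  shows "inv (commutator G a b) \<otimes> commutator G (a \<otimes> u) (b \<otimes> v) =
    inv (a \<otimes> b) \<otimes> (commutator G (inv b) c \<otimes> commutator G c e \<otimes> commutator G e (inv a)) \<otimes> (a \<otimes> b)"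
  using assms by (simp add: commutator_def word_simps)

text \<open>The derivative of the conjugate of \<open>b\<close> by \<open>a\<close> is again a conjugate by \<open>a\<close>, of an element
  that no longer involves \<open>a\<close> itself but only its derivative \<open>u\<close>.\<close>

lemma conj_increment:
  assumes "a \<in> carrier G" "b \<in> carrier G" "u \<in> carrier G" "v \<in> carrier G"
  shows "inv (a \<otimes> b \<otimes> inv a) \<otimes> ((a \<otimes> u) \<otimes> (b \<otimes> v) \<otimes> inv (a \<otimes> u)) =
    a \<otimes> (commutator G b (inv u) \<otimes> (u \<otimes> v \<otimes> inv u)) \<otimes> inv a"
  using assms by (simp add: commutator_def word_simps)

end

section \<open>Towers of polynomial maps\<close>

text \<open>The recursion for polynomial maps runs on a length, which becomes minus infinity after finitely
  many shifts. Here the family \<open>P\<close> of all shifts is described without the length: the recursive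
  equation holds at every index, including those at which the filtration is trivial. The equation
  alone does not determine \<open>P\<close>, since for nonempty \<open>\<T>\<close> it is also satisfied by \<open>P t = {}\<close> for all
  \<open>t\<close>; the last assumption anchors the recursion. Shifting by one turns a tower with bound \<open>N\<close>
  into one with bound \<open>N - 1\<close>, so that \<open>N\<close> serves as the induction parameter.\<close>

locale polynomial_tower = prefiltration G F
  for G :: "('a, 'm) monoid_scheme" (structure) and F :: "nat \<Rightarrow> 'a set" +
  fixes \<Gamma> :: "'x set" and \<T> :: "('x \<rightharpoonup> 'x) set" and P :: "nat \<Rightarrow> ('x \<Rightarrow> 'a) set" and N :: nat
  assumes dom_ran: "\<And>T. T \<in> \<T> \<Longrightarrow> dom T \<subseteq> \<Gamma> \<and> ran T \<subseteq> \<Gamma>"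
    and vanishes: "F N = {\<one>}"
    and P_eq: "\<And>t. P t = {g \<in> \<Gamma> \<rightarrow>\<^sub>E F t. \<forall>T\<in>\<T>. \<exists>h \<in> P (Suc t).
        \<forall>x\<in>dom T. h x = inv (g x) \<otimes> g (the (T x))}"
    and P_trivial: "\<And>t. F t = {\<one>} \<Longrightarrow> P t = \<Gamma> \<rightarrow>\<^sub>E {\<one>}"
begin

abbreviation maps :: "('x \<Rightarrow> 'a) monoid" where
  "maps \<equiv> product_group \<Gamma> (\<lambda>_. G)"

sublocale maps: group maps
  by simp

lemma maps_mult_apply: "x \<in> \<Gamma> \<Longrightarrow> (f \<otimes>\<^bsub>maps\<^esub> g) x = f x \<otimes> g x"
  by simp

lemma maps_inv_apply: "f \<in> carrier maps \<Longrightarrow> x \<in> \<Gamma> \<Longrightarrow> (inv\<^bsub>maps\<^esub> f) x = inv (f x)"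
  by simp

lemma maps_one_apply: "x \<in> \<Gamma> \<Longrightarrow> \<one>\<^bsub>maps\<^esub> x = \<one>"
  by simp

lemma maps_commutator_apply:
  "f \<in> carrier maps \<Longrightarrow> g \<in> carrier maps \<Longrightarrow> x \<in> \<Gamma> \<Longrightarrow>
    commutator maps f g x = commutator G (f x) (g x)"
  by (simp add: commutator_def)

lemma maps_commutator_closed:
  "f \<in> carrier maps \<Longrightarrow> g \<in> carrier maps \<Longrightarrow> commutator maps f g \<in> carrier maps"
  unfolding commutator_def by (intro maps.m_closed maps.inv_closed)

lemma maps_value: "f \<in> carrier maps \<Longrightarrow> x \<in> \<Gamma> \<Longrightarrow> f x \<in> carrier G"
  by auto

lemma maps_ext:
  "f \<in> carrier maps \<Longrightarrow> g \<in> carrier maps \<Longrightarrow> (\<And>x. x \<in> \<Gamma> \<Longrightarrow> f x = g x) \<Longrightarrow> f = g"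
  by (auto intro: PiE_ext)

lemma maps_values_in: "f \<in> carrier maps \<Longrightarrow> (\<And>x. x \<in> \<Gamma> \<Longrightarrow> f x \<in> S) \<Longrightarrow> f \<in> \<Gamma> \<rightarrow>\<^sub>E S"
  by (simp add: PiE_iff)

lemma maps_trivial: "\<Gamma> \<rightarrow>\<^sub>E {\<one>} = {\<one>\<^bsub>maps\<^esub>}"
  by (simp add: PiE_eq_singleton)

lemma maps_subset: "S \<subseteq> carrier G \<Longrightarrow> f \<in> \<Gamma> \<rightarrow>\<^sub>E S \<Longrightarrow> f \<in> carrier maps"
  by (auto simp: PiE_iff)

text \<open>From here on \<open>maps\<close> is treated as an abstract group, whose elements are evaluated at points
  only through the rules above; unfolding the pointwise operations would destroy every term to which
  a closure property of some \<open>P t\<close> applies.\<close>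

declare carrier_product_group [simp del] one_product_group [simp del]
  mult_product_group [simp del] inv_product_group [simp del]

lemmas maps_apply = maps_mult_apply maps_inv_apply maps_one_apply maps_commutator_apply
  maps_commutator_closed

lemma F_antimono: "i \<le> j \<Longrightarrow> F j \<subseteq> F i"
  by (rule lift_Suc_antimono_le[of F, OF nested])

lemma F_carrier: "a \<in> F i \<Longrightarrow> a \<in> carrier G"
  using subgroup.subset[OF subgroups] by blast

lemma F_vanishes: "N \<le> n \<Longrightarrow> F n = {\<one>}"
  using F_antimono[of N n] vanishes subgroup.one_closed[OF subgroups, of n] by blast

lemma P_vanishes: "N \<le> n \<Longrightarrow> P n = {\<one>\<^bsub>maps\<^esub>}"
  by (simp only: P_trivial F_vanishes maps_trivial)

lemma downward_induct [case_names vanishing step]: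
  assumes "\<And>n. N \<le> n \<Longrightarrow> Q n" and "\<And>n. Q (Suc n) \<Longrightarrow> Q n"
  shows "Q n"
proof (cases "N \<le> n")
  case False
  then have "n \<le> N" by simp
  then show ?thesis
  proof (induction rule: inc_induct)
    case base
    show ?case by (rule assms(1)) simp
  next
    case (step n)
    show ?case by (rule assms(2)) (fact step.IH)
  qed
qed (rule assms)

lemma commutator_F: "a \<in> F i \<Longrightarrow> b \<in> F j \<Longrightarrow> commutator G a b \<in> F (i + j)"
  by (rule subsetD[OF commutators commutator_in_commutator_subgroup])

lemma conj_F:
  assumes "a \<in> F 0" and "b \<in> F m"
  shows "a \<otimes> b \<otimes> inv a \<in> F m" and "inv a \<otimes> b \<otimes> a \<in> F m"
proof -
  have *: "inv c \<otimes> b \<otimes> c \<in> F m" if "c \<in> F 0" for c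
  proof -
    have "b \<otimes> commutator G b c \<in> F m"
      using commutator_F[OF assms(2) that] assms(2) subgroup.m_closed[OF subgroups] by simp
    then show ?thesis
      using that assms(2) by (simp add: conj_eq_mult_commutator F_carrier)
  qed
  from *[of a] assms(1) show "inv a \<otimes> b \<otimes> a \<in> F m" by simp
  from *[of "inv a"] assms(1) show "a \<otimes> b \<otimes> inv a \<in> F m"
    by (simp add: subgroup.m_inv_closed[OF subgroups] F_carrier)
qed

lemma P_values: "f \<in> P t \<Longrightarrow> f \<in> \<Gamma> \<rightarrow>\<^sub>E F t"
  by (subst (asm) P_eq) simp

lemma P_carrier: "f \<in> P t \<Longrightarrow> f \<in> carrier maps"
  using maps_subset[OF subgroup.subset[OF subgroups] P_values] .

lemma P_value: "f \<in> P t \<Longrightarrow> x \<in> \<Gamma> \<Longrightarrow> f x \<in> F t"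
  using P_values by (rule PiE_mem)

lemma P_value_carrier: "f \<in> P t \<Longrightarrow> x \<in> \<Gamma> \<Longrightarrow> f x \<in> carrier G"
  using P_value F_carrier by blast

lemma dom_points:
  assumes "T \<in> \<T>" and "x \<in> dom T"
  shows "x \<in> \<Gamma>" and "the (T x) \<in> \<Gamma>"
  using assms dom_ran[of T] by (auto simp: ran_def)

lemma P_derivative:
  assumes "f \<in> P t" and "T \<in> \<T>"
  obtains h where "h \<in> P (Suc t)" and "\<And>x. x \<in> dom T \<Longrightarrow> f (the (T x)) = f x \<otimes> h x"
proof -
  from assms obtain h where h: "h \<in> P (Suc t)"
      "\<And>x. x \<in> dom T \<Longrightarrow> h x = inv (f x) \<otimes> f (the (T x))"
    by (subst (asm) P_eq) auto
  moreover have "f (the (T x)) = f x \<otimes> h x" if "x \<in> dom T" for x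
    using h(2)[OF that] dom_points[OF assms(2) that] P_value_carrier[OF assms(1)]
    by (simp add: mult_inv_cancel_left)
  ultimately show thesis using that by blast
qed

lemma P_I:
  assumes "f \<in> carrier maps" and "\<And>x. x \<in> \<Gamma> \<Longrightarrow> f x \<in> F t"
    and "\<And>T. T \<in> \<T> \<Longrightarrow> \<exists>h \<in> P (Suc t). \<forall>x\<in>dom T. inv (f x) \<otimes> f (the (T x)) = h x"
  shows "f \<in> P t"
proof -
  have "f \<in> \<Gamma> \<rightarrow>\<^sub>E F t" using assms(1,2) by (rule maps_values_in)
  moreover have "\<forall>T\<in>\<T>. \<exists>h \<in> P (Suc t). \<forall>x\<in>dom T. h x = inv (f x) \<otimes> f (the (T x))"
    using assms(3) by metis
  ultimately show ?thesis by (subst P_eq) blast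
qed

lemma P_one: "\<one>\<^bsub>maps\<^esub> \<in> P t"
proof (induction t rule: downward_induct)
  case (vanishing n)
  then show ?case by (simp add: P_vanishes)
next
  case (step n)
  show ?case
  proof (rule P_I)
    show "\<exists>h \<in> P (Suc n). \<forall>x\<in>dom T. inv (\<one>\<^bsub>maps\<^esub> x) \<otimes> \<one>\<^bsub>maps\<^esub> (the (T x)) = h x"
      if "T \<in> \<T>" for T
      using step dom_points[OF that] by (intro bexI[of _ "\<one>\<^bsub>maps\<^esub>"]) (auto simp: maps_apply)
  qed (auto simp: maps_apply subgroup.one_closed[OF subgroups])
qed

lemma P_Suc: "P (Suc t) \<subseteq> P t"
proof (induction t rule: downward_induct)
  case (vanishing n)
  then show ?case by (simp add: P_vanishes)
next
  case (step n)
  show ?case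
  proof
    fix f assume f: "f \<in> P (Suc n)"
    show "f \<in> P n"
    proof (rule P_I)
      show "\<exists>h \<in> P (Suc n). \<forall>x\<in>dom T. inv (f x) \<otimes> f (the (T x)) = h x" if "T \<in> \<T>" for T
      proof -
        obtain h where h: "h \<in> P (Suc (Suc n))" "\<And>x. x \<in> dom T \<Longrightarrow> f (the (T x)) = f x \<otimes> h x"
          using P_derivative[OF f \<open>T \<in> \<T>\<close>] by blast
        have "inv (f x) \<otimes> f (the (T x)) = h x" if "x \<in> dom T" for x
          using h dom_points[OF \<open>T \<in> \<T>\<close> that] f that
          by (simp add: inv_mult_cancel_left P_value_carrier)
        then show ?thesis using h(1) step by blast
      qed
    qed (use f P_carrier P_value nested in blast)+
  qed
qed

lemma P_antimono: "i \<le> j \<Longrightarrow> P j \<subseteq> P i"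
  by (rule lift_Suc_antimono_le[of P, OF P_Suc])

end

section \<open>The step of the induction on the length\<close>

text \<open>The assumptions are what the theorem for the filtration shifted by one provides. With \<open>i = k + 1\<close>
  and \<open>j = l + 1\<close>, the shifted tower places a commutator at its index \<open>k + l\<close>, which is the index
  \<open>i + j - 1\<close> of the original one.\<close>

locale polynomial_tower_step = polynomial_tower +
  assumes P_subgroup: "\<And>i. 0 < i \<Longrightarrow> subgroup (P i) maps"
    and P_weak_commutator: "\<And>i j f g. 0 < i \<Longrightarrow> 0 < j \<Longrightarrow> f \<in> P i \<Longrightarrow> g \<in> P j \<Longrightarrow>
      commutator maps f g \<in> P (i + j - 1)"
begin

lemmas P_mult = subgroup.m_closed[OF P_subgroup]
lemmas P_inv = subgroup.m_inv_closed[OF P_subgroup]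

text \<open>The off-by-one estimate is enough here: \<open>m + i - 1 \<ge> m\<close> for positive \<open>i\<close>.\<close>

lemma P_conj_pos:
  assumes "0 < i" "0 < m" and "f \<in> P i" and "g \<in> P m"
  shows "inv\<^bsub>maps\<^esub> f \<otimes>\<^bsub>maps\<^esub> g \<otimes>\<^bsub>maps\<^esub> f \<in> P m"
    and "f \<otimes>\<^bsub>maps\<^esub> g \<otimes>\<^bsub>maps\<^esub> inv\<^bsub>maps\<^esub> f \<in> P m"
proof -
  have *: "inv\<^bsub>maps\<^esub> f \<otimes>\<^bsub>maps\<^esub> g \<otimes>\<^bsub>maps\<^esub> f \<in> P m" if "f \<in> P i" for f
  proof -
    have "commutator maps g f \<in> P m"
      using P_weak_commutator[OF assms(2,1,4) that] P_antimono[of m "m + i - 1"] assms(1)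
      by (simp add: subset_iff)
    then show ?thesis
      by (simp only: maps.conj_eq_mult_commutator[OF P_carrier[OF that] P_carrier[OF assms(4)]]
          P_mult[OF assms(2,4)])
  qed
  from *[OF assms(3)] show "inv\<^bsub>maps\<^esub> f \<otimes>\<^bsub>maps\<^esub> g \<otimes>\<^bsub>maps\<^esub> f \<in> P m" .
  from *[OF P_inv[OF assms(1,3)]]
  show "f \<otimes>\<^bsub>maps\<^esub> g \<otimes>\<^bsub>maps\<^esub> inv\<^bsub>maps\<^esub> f \<in> P m"
    by (simp only: maps.inv_inv[OF P_carrier[OF assms(3)]])
qed

text \<open>The derivative given by \<open>commutator_increment\<close> consists of commutators of total index at least
  \<open>i + j + 1\<close>, to which the downward induction on \<open>i + j\<close> applies; the conjugation by \<open>f g\<close> is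
  harmless because \<open>f g\<close> lies in a group of positive index.\<close>

lemma P_commutator_pos:
  assumes "0 < i" "0 < j" and "f \<in> P i" and "g \<in> P j"
  shows "commutator maps f g \<in> P (i + j)"
proof -
  have "\<forall>i j f g. 0 < i \<longrightarrow> 0 < j \<longrightarrow> i + j = n \<longrightarrow> f \<in> P i \<longrightarrow> g \<in> P j \<longrightarrow>
    commutator maps f g \<in> P n" for n
  proof (induction n rule: downward_induct)
    case (vanishing n)
    have "commutator maps f g = \<one>\<^bsub>maps\<^esub>" if "i + j = n" "f \<in> P i" "g \<in> P j" for i j f g
    proof (rule maps_ext)
      note carriers = P_carrier[OF that(2)] P_carrier[OF that(3)]
      show "commutator maps f g \<in> carrier maps" "\<one>\<^bsub>maps\<^esub> \<in> carrier maps"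
        using carriers by (simp_all add: maps_apply)
      show "commutator maps f g x = \<one>\<^bsub>maps\<^esub> x" if "x \<in> \<Gamma>" for x
        using commutator_F[OF P_value P_value, OF \<open>f \<in> P i\<close> that \<open>g \<in> P j\<close> that]
          \<open>i + j = n\<close> F_vanishes[OF vanishing] that carriers
        by (simp add: maps_apply)
    qed
    then show ?case using P_one by metis
  next
    case (step n)
    have "commutator maps f g \<in> P n"
      if pos: "0 < i" "0 < j" and n: "i + j = n" and f: "f \<in> P i" and g: "g \<in> P j" for i j f g
    proof (rule P_I)
      show "commutator maps f g \<in> carrier maps"
        by (simp add: maps_apply P_carrier[OF f] P_carrier[OF g])
      show "commutator maps f g x \<in> F n" if "x \<in> \<Gamma>" for x
        using commutator_F[OF P_value[OF f that] P_value[OF g that]] n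
        by (simp add: maps_apply P_carrier[OF f] P_carrier[OF g] that)
    next
      fix T assume T: "T \<in> \<T>"
      obtain u where u: "u \<in> P (Suc i)" "\<And>x. x \<in> dom T \<Longrightarrow> f (the (T x)) = f x \<otimes> u x"
        using P_derivative[OF f T] by blast
      obtain v where v: "v \<in> P (Suc j)" "\<And>x. x \<in> dom T \<Longrightarrow> g (the (T x)) = g x \<otimes> v x"
        using P_derivative[OF g T] by blast
      define c where "c = f \<otimes>\<^bsub>maps\<^esub> u \<otimes>\<^bsub>maps\<^esub> inv\<^bsub>maps\<^esub> f"
      define e where "e = g \<otimes>\<^bsub>maps\<^esub> v \<otimes>\<^bsub>maps\<^esub> inv\<^bsub>maps\<^esub> g"
      define w where "w = commutator maps (inv\<^bsub>maps\<^esub> g) c \<otimes>\<^bsub>maps\<^esub> commutator maps c e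
        \<otimes>\<^bsub>maps\<^esub> commutator maps e (inv\<^bsub>maps\<^esub> f)"
      have c: "c \<in> P (Suc i)" unfolding c_def using P_conj_pos(2)[OF pos(1) _ f u(1)] by simp
      have e: "e \<in> P (Suc j)" unfolding e_def using P_conj_pos(2)[OF pos(2) _ g v(1)] by simp
      \<comment> \<open>The commutator of \<open>c\<close> and \<open>e\<close> even has index \<open>i + j + 2\<close>; weakening the index of \<open>e\<close>
        lets the induction hypothesis for \<open>i + j + 1\<close> cover it too.\<close>
      have e': "e \<in> P j" using e P_Suc by blast
      note IH = step[rule_format]
      have "w \<in> P (Suc n)"
        unfolding w_def
      proof (intro P_mult)
        show "commutator maps (inv\<^bsub>maps\<^esub> g) c \<in> P (Suc n)"
          using n by (intro IH[OF pos(2) _ _ P_inv[OF pos(2) g] c]) auto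
        show "commutator maps c e \<in> P (Suc n)"
          using n pos by (intro IH[OF _ _ _ c e']) auto
        show "commutator maps e (inv\<^bsub>maps\<^esub> f) \<in> P (Suc n)"
          using n by (intro IH[OF _ pos(1) _ e P_inv[OF pos(1) f]]) auto
      qed simp_all
      moreover have "0 < min i j" using pos by simp
      moreover have "f \<otimes>\<^bsub>maps\<^esub> g \<in> P (min i j)"
        using pos f g P_antimono[of "min i j" i] P_antimono[of "min i j" j]
        by (intro P_mult) auto
      ultimately have
        "inv\<^bsub>maps\<^esub> (f \<otimes>\<^bsub>maps\<^esub> g) \<otimes>\<^bsub>maps\<^esub> w \<otimes>\<^bsub>maps\<^esub> (f \<otimes>\<^bsub>maps\<^esub> g) \<in> P (Suc n)"
        using P_conj_pos(1) by blast
      moreover have "inv (commutator maps f g x) \<otimes> commutator maps f g (the (T x)) =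
          (inv\<^bsub>maps\<^esub> (f \<otimes>\<^bsub>maps\<^esub> g) \<otimes>\<^bsub>maps\<^esub> w \<otimes>\<^bsub>maps\<^esub> (f \<otimes>\<^bsub>maps\<^esub> g)) x"
        if x: "x \<in> dom T" for x
      proof -
        note pts = dom_points[OF T x]
        note vals = P_value_carrier[OF f pts(1)] P_value_carrier[OF g pts(1)]
          P_value_carrier[OF u(1) pts(1)] P_value_carrier[OF v(1) pts(1)]
        have "inv (commutator maps f g x) \<otimes> commutator maps f g (the (T x)) =
            inv (commutator G (f x) (g x)) \<otimes> commutator G (f x \<otimes> u x) (g x \<otimes> v x)"
          using pts by (simp add: maps_apply P_carrier[OF f] P_carrier[OF g] u(2) v(2) x)
        also note commutator_increment[OF vals]
        also have "inv (f x \<otimes> g x) \<otimes> (commutator G (inv (g x)) (f x \<otimes> u x \<otimes> inv (f x)) \<otimes>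
            commutator G (f x \<otimes> u x \<otimes> inv (f x)) (g x \<otimes> v x \<otimes> inv (g x)) \<otimes>
            commutator G (g x \<otimes> v x \<otimes> inv (g x)) (inv (f x))) \<otimes> (f x \<otimes> g x) =
          (inv\<^bsub>maps\<^esub> (f \<otimes>\<^bsub>maps\<^esub> g) \<otimes>\<^bsub>maps\<^esub> w \<otimes>\<^bsub>maps\<^esub> (f \<otimes>\<^bsub>maps\<^esub> g)) x"
          using pts P_carrier[OF f] P_carrier[OF g] P_carrier[OF u(1)] P_carrier[OF v(1)]
          unfolding w_def c_def e_def by (simp add: maps_apply)
        finally show ?thesis .
      qed
      ultimately show "\<exists>h\<in>P (Suc n). \<forall>x\<in>dom T.
          inv (commutator maps f g x) \<otimes> commutator maps f g (the (T x)) = h x"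
        by blast
    qed
    then show ?case by blast
  qed
  with assms show ?thesis by blast
qed

text \<open>By \<open>conj_increment\<close>, the derivative of \<open>f g f\<inverse>\<close> is \<open>f ([g, u\<inverse>] \<cdot> u v u\<inverse>) f\<inverse>\<close>. The inner map lies
  in \<open>P (m + 1)\<close>, because \<open>u\<close> and \<open>u\<inverse>\<close> lie in \<open>P 1\<close>, and the outer conjugation is covered by the
  downward induction on \<open>m\<close>. The inverse of \<open>f\<close> occurs only as an element of \<open>maps\<close>, so the result
  can be used to prove that \<open>P 0\<close> is closed under inverses.\<close>

lemma P_conj:
  assumes "0 < m" and "f \<in> P 0" and "g \<in> P m"
  shows "f \<otimes>\<^bsub>maps\<^esub> g \<otimes>\<^bsub>maps\<^esub> inv\<^bsub>maps\<^esub> f \<in> P m"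
proof -
  note f = P_carrier[OF assms(2)]
  have "0 < n \<longrightarrow> (\<forall>g\<in>P n. f \<otimes>\<^bsub>maps\<^esub> g \<otimes>\<^bsub>maps\<^esub> inv\<^bsub>maps\<^esub> f \<in> P n)" for n
  proof (induction n rule: downward_induct)
    case (vanishing n)
    then show ?case using f by (simp add: P_vanishes)
  next
    case (step n)
    have "f \<otimes>\<^bsub>maps\<^esub> g \<otimes>\<^bsub>maps\<^esub> inv\<^bsub>maps\<^esub> f \<in> P n" if "0 < n" and g: "g \<in> P n" for g
    proof (rule P_I)
      show "f \<otimes>\<^bsub>maps\<^esub> g \<otimes>\<^bsub>maps\<^esub> inv\<^bsub>maps\<^esub> f \<in> carrier maps"
        using f P_carrier[OF g] by simp
      show "(f \<otimes>\<^bsub>maps\<^esub> g \<otimes>\<^bsub>maps\<^esub> inv\<^bsub>maps\<^esub> f) x \<in> F n" if "x \<in> \<Gamma>" for x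
        using that f conj_F(1)[OF P_value[OF assms(2)] P_value[OF g]] by (simp add: maps_apply)
    next
      fix T assume T: "T \<in> \<T>"
      obtain u where u: "u \<in> P 1" "\<And>x. x \<in> dom T \<Longrightarrow> f (the (T x)) = f x \<otimes> u x"
        using P_derivative[OF assms(2) T] by (metis One_nat_def)
      obtain v where v: "v \<in> P (Suc n)" "\<And>x. x \<in> dom T \<Longrightarrow> g (the (T x)) = g x \<otimes> v x"
        using P_derivative[OF g T] by blast
      define w where "w = commutator maps g (inv\<^bsub>maps\<^esub> u) \<otimes>\<^bsub>maps\<^esub>
        (u \<otimes>\<^bsub>maps\<^esub> v \<otimes>\<^bsub>maps\<^esub> inv\<^bsub>maps\<^esub> u)"
      have "commutator maps g (inv\<^bsub>maps\<^esub> u) \<in> P (Suc n)"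
        using P_commutator_pos[OF \<open>0 < n\<close> _ g P_inv[OF _ u(1)]] by simp
      moreover have "u \<otimes>\<^bsub>maps\<^esub> v \<otimes>\<^bsub>maps\<^esub> inv\<^bsub>maps\<^esub> u \<in> P (Suc n)"
        by (rule P_conj_pos(2)[OF _ _ u(1) v(1)]) simp_all
      ultimately have "w \<in> P (Suc n)" unfolding w_def using P_mult by blast
      with step have "f \<otimes>\<^bsub>maps\<^esub> w \<otimes>\<^bsub>maps\<^esub> inv\<^bsub>maps\<^esub> f \<in> P (Suc n)" by blast
      moreover have "inv ((f \<otimes>\<^bsub>maps\<^esub> g \<otimes>\<^bsub>maps\<^esub> inv\<^bsub>maps\<^esub> f) x) \<otimes>
          (f \<otimes>\<^bsub>maps\<^esub> g \<otimes>\<^bsub>maps\<^esub> inv\<^bsub>maps\<^esub> f) (the (T x)) =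
          (f \<otimes>\<^bsub>maps\<^esub> w \<otimes>\<^bsub>maps\<^esub> inv\<^bsub>maps\<^esub> f) x" if x: "x \<in> dom T" for x
      proof -
        note pts = dom_points[OF T x]
        note carriers = f P_carrier[OF g] P_carrier[OF u(1)] P_carrier[OF v(1)]
        have "(f \<otimes>\<^bsub>maps\<^esub> g \<otimes>\<^bsub>maps\<^esub> inv\<^bsub>maps\<^esub> f) x = f x \<otimes> g x \<otimes> inv (f x)"
          "(f \<otimes>\<^bsub>maps\<^esub> g \<otimes>\<^bsub>maps\<^esub> inv\<^bsub>maps\<^esub> f) (the (T x)) =
            (f x \<otimes> u x) \<otimes> (g x \<otimes> v x) \<otimes> inv (f x \<otimes> u x)"
          "(f \<otimes>\<^bsub>maps\<^esub> w \<otimes>\<^bsub>maps\<^esub> inv\<^bsub>maps\<^esub> f) x =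
            f x \<otimes> (commutator G (g x) (inv (u x)) \<otimes> (u x \<otimes> v x \<otimes> inv (u x))) \<otimes> inv (f x)"
          using pts carriers x by (simp_all add: w_def maps_apply u(2) v(2))
        then show ?thesis
          using conj_increment[OF carriers[THEN maps_value, OF pts(1)]] by simp
      qed
      ultimately show "\<exists>h\<in>P (Suc n). \<forall>x\<in>dom T.
          inv ((f \<otimes>\<^bsub>maps\<^esub> g \<otimes>\<^bsub>maps\<^esub> inv\<^bsub>maps\<^esub> f) x) \<otimes>
          (f \<otimes>\<^bsub>maps\<^esub> g \<otimes>\<^bsub>maps\<^esub> inv\<^bsub>maps\<^esub> f) (the (T x)) = h x"
        by blast
    qed
    then show ?case by blast
  qed
  with assms show ?thesis by blast
qed

text \<open>The derivative of \<open>f\<inverse>\<close> is \<open>f (f u)\<inverse> = (f u f\<inverse>)\<inverse>\<close>.\<close>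

lemma P_zero_inv:
  assumes "f \<in> P 0"
  shows "inv\<^bsub>maps\<^esub> f \<in> P 0"
proof (rule P_I)
  note f = P_carrier[OF assms]
  show "inv\<^bsub>maps\<^esub> f \<in> carrier maps" using f by simp
  show "(inv\<^bsub>maps\<^esub> f) x \<in> F 0" if "x \<in> \<Gamma>" for x
    using that f subgroup.m_inv_closed[OF subgroups P_value[OF assms]] by (simp add: maps_apply)
  fix T assume T: "T \<in> \<T>"
  obtain u where u: "u \<in> P 1" "\<And>x. x \<in> dom T \<Longrightarrow> f (the (T x)) = f x \<otimes> u x"
    using P_derivative[OF assms T] by (metis One_nat_def)
  let ?h = "inv\<^bsub>maps\<^esub> (f \<otimes>\<^bsub>maps\<^esub> u \<otimes>\<^bsub>maps\<^esub> inv\<^bsub>maps\<^esub> f)"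
  have "?h \<in> P (Suc 0)"
    using P_inv[OF _ P_conj[OF _ assms u(1)]] by simp
  moreover have "inv ((inv\<^bsub>maps\<^esub> f) x) \<otimes> (inv\<^bsub>maps\<^esub> f) (the (T x)) = ?h x" if x: "x \<in> dom T" for x
  proof -
    note pts = dom_points[OF T x]
    have vals: "f x \<in> carrier G" "u x \<in> carrier G"
      using P_value_carrier[OF assms pts(1)] P_value_carrier[OF u(1) pts(1)] by auto
    have "inv ((inv\<^bsub>maps\<^esub> f) x) \<otimes> (inv\<^bsub>maps\<^esub> f) (the (T x)) = inv (inv (f x)) \<otimes> inv (f x \<otimes> u x)"
      "?h x = inv (f x \<otimes> u x \<otimes> inv (f x))"
      using pts f P_carrier[OF u(1)] x by (simp_all add: maps_apply u(2))
    then show ?thesis using vals by (simp add: word_simps)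
  qed
  ultimately show "\<exists>h\<in>P (Suc 0). \<forall>x\<in>dom T.
      inv ((inv\<^bsub>maps\<^esub> f) x) \<otimes> (inv\<^bsub>maps\<^esub> f) (the (T x)) = h x"
    by blast
qed

lemma P_conj_inv:
  assumes "0 < m" and "f \<in> P 0" and "g \<in> P m"
  shows "inv\<^bsub>maps\<^esub> f \<otimes>\<^bsub>maps\<^esub> g \<otimes>\<^bsub>maps\<^esub> f \<in> P m"
  using P_conj[OF assms(1) P_zero_inv[OF assms(2)] assms(3)] P_carrier[OF assms(2)] by simp

text \<open>The derivative of \<open>f g\<close> is \<open>(f g)\<inverse> f u g v = g\<inverse> u g \<cdot> v\<close>.\<close>

lemma P_zero_mult:
  assumes "f \<in> P 0" and "g \<in> P 0"
  shows "f \<otimes>\<^bsub>maps\<^esub> g \<in> P 0"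
proof (rule P_I)
  note carriers = P_carrier[OF assms(1)] P_carrier[OF assms(2)]
  show "f \<otimes>\<^bsub>maps\<^esub> g \<in> carrier maps" using carriers by simp
  show "(f \<otimes>\<^bsub>maps\<^esub> g) x \<in> F 0" if "x \<in> \<Gamma>" for x
    using that subgroup.m_closed[OF subgroups P_value[OF assms(1)] P_value[OF assms(2)]]
    by (simp add: maps_apply)
  fix T assume T: "T \<in> \<T>"
  obtain u where u: "u \<in> P 1" "\<And>x. x \<in> dom T \<Longrightarrow> f (the (T x)) = f x \<otimes> u x"
    using P_derivative[OF assms(1) T] by (metis One_nat_def)
  obtain v where v: "v \<in> P 1" "\<And>x. x \<in> dom T \<Longrightarrow> g (the (T x)) = g x \<otimes> v x"
    using P_derivative[OF assms(2) T] by (metis One_nat_def)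
  let ?h = "inv\<^bsub>maps\<^esub> g \<otimes>\<^bsub>maps\<^esub> u \<otimes>\<^bsub>maps\<^esub> g \<otimes>\<^bsub>maps\<^esub> v"
  have "?h \<in> P (Suc 0)"
    using P_mult[OF _ P_conj_inv[OF _ assms(2) u(1)] v(1)] by simp
  moreover have "inv ((f \<otimes>\<^bsub>maps\<^esub> g) x) \<otimes> (f \<otimes>\<^bsub>maps\<^esub> g) (the (T x)) = ?h x"
    if x: "x \<in> dom T" for x
  proof -
    note pts = dom_points[OF T x]
    have vals: "f x \<in> carrier G" "g x \<in> carrier G" "u x \<in> carrier G" "v x \<in> carrier G"
      using pts(1) assms u(1) v(1) by (blast intro: P_value_carrier)+
    have "inv ((f \<otimes>\<^bsub>maps\<^esub> g) x) \<otimes> (f \<otimes>\<^bsub>maps\<^esub> g) (the (T x)) =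
        inv (f x \<otimes> g x) \<otimes> (f x \<otimes> u x \<otimes> (g x \<otimes> v x))"
      "?h x = inv (g x) \<otimes> u x \<otimes> g x \<otimes> v x"
      using pts carriers x by (simp_all add: maps_apply u(2) v(2))
    then show ?thesis using vals by (simp add: word_simps)
  qed
  ultimately show "\<exists>h\<in>P (Suc 0). \<forall>x\<in>dom T.
      inv ((f \<otimes>\<^bsub>maps\<^esub> g) x) \<otimes> (f \<otimes>\<^bsub>maps\<^esub> g) (the (T x)) = h x"
    by blast
qed

lemma P_is_subgroup: "subgroup (P i) maps"
proof (cases "0 < i")
  case False
  moreover have "subgroup (P 0) maps"
    using P_one P_carrier P_zero_inv P_zero_mult by (intro maps.subgroupI) blast+
  ultimately show ?thesis by simp
qed (rule P_subgroup)

text \<open>When one index is zero, the commutator is a product of two elements of the group of the other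
  index, by normality.\<close>

lemma P_commutator:
  assumes f: "f \<in> P i" and g: "g \<in> P j"
  shows "commutator maps f g \<in> P (i + j)"
proof -
  note mult = subgroup.m_closed[OF P_is_subgroup]
  note inver = subgroup.m_inv_closed[OF P_is_subgroup]
  note carriers = P_carrier[OF f] P_carrier[OF g]
  consider "0 < i" "0 < j" | "i = 0" "0 < j" | "j = 0" "0 < i" | "i = 0" "j = 0" by blast
  then show ?thesis
  proof cases
    case 1
    then show ?thesis using P_commutator_pos f g by blast
  next
    case 2
    have "inv\<^bsub>maps\<^esub> f \<otimes>\<^bsub>maps\<^esub> inv\<^bsub>maps\<^esub> g \<otimes>\<^bsub>maps\<^esub> f \<otimes>\<^bsub>maps\<^esub> g \<in> P j"
      using 2 f g by (intro mult P_conj_inv inver) auto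
    then show ?thesis using 2 by (simp add: commutator_def)
  next
    case 3
    have "inv\<^bsub>maps\<^esub> f \<otimes>\<^bsub>maps\<^esub> (inv\<^bsub>maps\<^esub> g \<otimes>\<^bsub>maps\<^esub> f \<otimes>\<^bsub>maps\<^esub> g) \<in> P i"
      using 3 f g by (intro mult P_conj_inv inver) auto
    then show ?thesis using 3 carriers by (simp add: commutator_def maps.m_assoc)
  next
    case 4
    then show ?thesis unfolding commutator_def using f g by (auto intro!: mult inver)
  qed
qed

end

section \<open>The prefiltration of polynomial maps\<close>

lemma (in polynomial_tower) tower_shift:
  assumes "N = Suc M"
  shows "polynomial_tower G (shift F 1) \<Gamma> \<T> (\<lambda>t. P (Suc t)) M"
proof (intro polynomial_tower.intro polynomial_tower_axioms.intro)
  show "prefiltration G (shift F 1)" by (rule prefiltration_shift) unfold_locales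
  show "dom T \<subseteq> \<Gamma> \<and> ran T \<subseteq> \<Gamma>" if "T \<in> \<T>" for T using that by (rule dom_ran)
  show "shift F 1 M = {\<one>}" using vanishes assms by (simp add: shift_def)
  show "P (Suc t) = {g \<in> \<Gamma> \<rightarrow>\<^sub>E shift F 1 t. \<forall>T\<in>\<T>. \<exists>h \<in> P (Suc (Suc t)).
        \<forall>x\<in>dom T. h x = inv (g x) \<otimes> g (the (T x))}" for t
    using P_eq[of "Suc t"] by (simp add: shift_def)
  show "P (Suc t) = \<Gamma> \<rightarrow>\<^sub>E {\<one>}" if "shift F 1 t = {\<one>}" for t
    using that P_trivial by (simp add: shift_def)
qed

lemma polynomial_tower_prefiltration:
  assumes "polynomial_tower G F \<Gamma> \<T> P N"
  shows "prefiltration (product_group \<Gamma> (\<lambda>_. G)) P"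
proof -
  have closed: "(\<forall>i. subgroup (P i) (product_group \<Gamma> (\<lambda>_. G))) \<and>
    (\<forall>i j. \<forall>f\<in>P i. \<forall>g\<in>P j. commutator (product_group \<Gamma> (\<lambda>_. G)) f g \<in> P (i + j))"
    using assms
  proof (induction N arbitrary: F P)
    case 0
    interpret polynomial_tower G F \<Gamma> \<T> P 0 by fact
    have "P i = {\<one>\<^bsub>maps\<^esub>}" for i by (rule P_vanishes) simp
    then show ?case by (simp add: commutator_def maps.triv_subgroup)
  next
    case (Suc N)
    interpret polynomial_tower G F \<Gamma> \<T> P "Suc N" by fact
    note IH = Suc.IH[OF tower_shift[OF refl]]
    interpret polynomial_tower_step G F \<Gamma> \<T> P "Suc N"
    proof (intro polynomial_tower_step.intro polynomial_tower_step_axioms.intro)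
      show "polynomial_tower G F \<Gamma> \<T> P (Suc N)" by fact
      show "subgroup (P i) maps" if pos: "0 < i" for i
      proof -
        obtain k where "i = Suc k" using pos by (cases i) auto
        with IH show ?thesis by blast
      qed
      show "commutator maps f g \<in> P (i + j - 1)"
        if pos: "0 < i" "0 < j" and "f \<in> P i" "g \<in> P j" for i j f g
      proof -
        obtain k l where kl: "i = Suc k" "j = Suc l" using pos by (cases i; cases j) auto
        with IH \<open>f \<in> P i\<close> \<open>g \<in> P j\<close> have "commutator maps f g \<in> P (Suc (k + l))" by blast
        with kl show ?thesis by simp
      qed
    qed
    show ?case using P_is_subgroup P_commutator by blast
  qed
  interpret polynomial_tower G F \<Gamma> \<T> P N by fact
  have "commutator_subgroup maps (P i) (P j) \<subseteq> P (i + j)" for i j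
    unfolding commutator_subgroup_def
  proof (rule maps.generate_subgroup_incl)
    show "subgroup (P (i + j)) maps" using closed by blast
    show "(\<Union>f\<in>P i. \<Union>g\<in>P j. {inv\<^bsub>maps\<^esub> f \<otimes>\<^bsub>maps\<^esub> inv\<^bsub>maps\<^esub> g \<otimes>\<^bsub>maps\<^esub> f \<otimes>\<^bsub>maps\<^esub> g}) \<subseteq> P (i + j)"
      using closed by (force simp only: commutator_def)
  qed
  with closed P_Suc show ?thesis
    by (intro prefiltration.intro prefiltration_axioms.intro maps.group_axioms) blast+
qed

text \<open>At an index where the length has dropped to minus infinity, the defining equation has no clause
  about derivatives. There the trivial filtration also has length \<open>0\<close>, and the set of polynomial
  maps is the same for both lengths, so the recursive clause holds at these indices as well.\<close>

lemma polynomial_maps_tower: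
  fixes G :: "('a, 'm) monoid_scheme" and F :: "nat \<Rightarrow> 'a set" and \<T> :: "('x \<rightharpoonup> 'x) set"
  assumes "prefiltration G F" and "has_length G F d"
    and "\<And>T. T \<in> \<T> \<Longrightarrow> dom T \<subseteq> \<Gamma> \<and> ran T \<subseteq> \<Gamma>"
  shows "polynomial_tower G F \<Gamma> \<T> (\<lambda>t. polynomial_maps G \<Gamma> \<T> (length_minus d t) (shift F t))
    (case d of Minus_Infinity \<Rightarrow> 0 | Finite n \<Rightarrow> Suc n)"
proof (intro polynomial_tower.intro polynomial_tower_axioms.intro)
  let ?P = "\<lambda>t. polynomial_maps G \<Gamma> \<T> (length_minus d t) (shift F t)"
  interpret prefiltration G F by fact
  show "prefiltration G F" by fact
  show "dom T \<subseteq> \<Gamma> \<and> ran T \<subseteq> \<Gamma>" if "T \<in> \<T>" for T using that by (rule assms(3))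
  show "F (case d of Minus_Infinity \<Rightarrow> 0 | Finite n \<Rightarrow> Suc n) = {\<one>\<^bsub>G\<^esub>}"
    using assms(2) by (cases d) auto
  have step: "length_minus d (Suc t) = length_minus (length_minus d t) 1"
      "shift F (Suc t) = shift (shift F t) 1" for t
    by (cases d; simp add: shift_def)+
  show "?P t = {g \<in> \<Gamma> \<rightarrow>\<^sub>E F t. \<forall>T\<in>\<T>. \<exists>h \<in> ?P (Suc t).
      \<forall>x\<in>dom T. h x = inv\<^bsub>G\<^esub> (g x) \<otimes>\<^bsub>G\<^esub> g (the (T x))}" for t
  proof -
    have len: "has_length G (shift F t) (length_minus d t)"
      by (rule has_length_shift[OF assms(1,2)])
    obtain n where n: "has_length G (shift F t) (Finite n)"
        "length_minus (Finite n) 1 = length_minus (length_minus d t) 1"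
    proof (cases "length_minus d t")
      case Minus_Infinity
      then have "has_length G (shift F t) (Finite 0)"
        using len has_length_shift[OF prefiltration_shift[OF assms(1)] len, of 1]
        by (simp add: shift_def)
      then show thesis using that[of 0] Minus_Infinity by simp
    next
      case (Finite n)
      then show thesis using that[of n] len by simp
    qed
    have "?P t = polynomial_maps G \<Gamma> \<T> (Finite n) (shift F t)"
      by (rule polynomial_maps_length_irrelevant[OF prefiltration_shift[OF assms(1)] len n(1) assms(3)])
    also have "\<dots> = {g \<in> \<Gamma> \<rightarrow>\<^sub>E shift F t 0. \<forall>T\<in>\<T>. \<exists>h \<in> ?P (Suc t).
        \<forall>x\<in>dom T. h x = inv\<^bsub>G\<^esub> (g x) \<otimes>\<^bsub>G\<^esub> g (the (T x))}"
      unfolding polynomial_maps.simps(2) n(2) step ..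
    finally show ?thesis by (simp only: shift_def add_0)
  qed
  show "?P t = \<Gamma> \<rightarrow>\<^sub>E {\<one>\<^bsub>G\<^esub>}" if "F t = {\<one>\<^bsub>G\<^esub>}" for t
  proof -
    have "shift F t i = {\<one>\<^bsub>G\<^esub>}" for i
      using has_length_shift[OF prefiltration_shift[OF assms(1), of t], of Minus_Infinity i] that
      by (simp add: shift_def)
    from polynomial_maps_trivial[OF is_group this assms(3)] show ?thesis
      using that by (simp add: shift_def)
  qed
qed

theorem corollary1p27:
  fixes G :: "('a, 'm) monoid_scheme"
    and F :: "nat \<Rightarrow> 'a set"
    and d :: prefiltration_length
    and \<Gamma> :: "'x set"
    and \<T> :: "('x \<rightharpoonup> 'x) set"
  assumes "prefiltration G F"
    and "has_length G F d"
    and "\<And>T. T \<in> \<T> \<Longrightarrow> dom T \<subseteq> \<Gamma> \<and> ran T \<subseteq> \<Gamma>"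
  shows "subgroup (polynomial_maps G \<Gamma> \<T> d F) (product_group \<Gamma> (\<lambda>_. G))
    \<and> prefiltration (product_group \<Gamma> (\<lambda>_. G))
         (\<lambda>t. polynomial_maps G \<Gamma> \<T> (length_minus d t) (shift F t))
    \<and> has_length (product_group \<Gamma> (\<lambda>_. G))
         (\<lambda>t. polynomial_maps G \<Gamma> \<T> (length_minus d t) (shift F t)) d"
proof -
  let ?P = "\<lambda>t. polynomial_maps G \<Gamma> \<T> (length_minus d t) (shift F t)"
  interpret polynomial_tower G F \<Gamma> \<T> ?P "case d of Minus_Infinity \<Rightarrow> 0 | Finite n \<Rightarrow> Suc n"
    by (rule polynomial_maps_tower[OF assms])
  have pre: "prefiltration maps ?P"
    by (rule polynomial_tower_prefiltration[OF polynomial_tower_axioms])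
  have "?P 0 = polynomial_maps G \<Gamma> \<T> d F"
    by (cases d) (simp_all add: shift_def)
  moreover have "subgroup (?P 0) maps"
    by (rule prefiltration.subgroups[OF pre])
  moreover have "has_length maps ?P d"
  proof (cases d)
    case Minus_Infinity
    then show ?thesis using P_vanishes[of 0] by simp
  next
    case (Finite n)
    then show ?thesis using P_vanishes[of "Suc n"] by simp
  qed
  ultimately show ?thesis using pre by simp
qed

end
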